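(* Let $\alpha>-1$ be real, let $n\ge1$ be an integer, let $c$ be a constant and let $L^{(\alpha)}_{n;c}(x)=L^{(\alpha)}_n(x)+c\,L^{(\alpha)}_{n-1}(x)$. Then \[ \operatorname{disc}(L^{(\alpha)}_{n;c})=\frac{1}{n+\alpha+cn}\prod_{k=1}^nk^{k-2n+3}\prod_{k=1}^{n-1}(k+\alpha)^{k-1}\cdot(-c)^nL^{(\alpha)}_{n;c}\!\left(\frac{nc^2+(2n+\alpha)c+n+\alpha}{c}\right). \] Furthermore, $\operatorname{disc}(L^{(\alpha)}_{n;c})$ is a polynomial in $c$ of degree $2(n-1)$.
   Context: $L^{(\alpha)}_n$ is the $n$-th Laguerre polynomial, $L^{(\alpha)}_n(x)=\frac{e^xx^{-\alpha}}{n!}\frac{d^n}{dx^n}(e^{-x}x^{n+\alpha})=\sum_{k=0}^n\binom{n+\alpha}{n-k}\frac{(-x)^k}{k!}$. Constants are real or complex numbers. For $f=a_0\prod_{i=1}^n(x-\alpha_i)$ of degree $n$, $\operatorname{disc}(f)=a_0^{2n-2}\prod_{1\le i<j\le n}(\alpha_i-\alpha_j)^2$. The displayed formula is an identity of rational functions in $c$: it holds literally where $c\ne0$ and $n+\alpha+cn\neq0$, and at the remaining values of $c$ the right-hand side (whose singularities are removable) is read by continuity. *)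

theory Defs
  imports "HOL-Analysis.Analysis" "HOL-Computational_Algebra.Computational_Algebra"
    "HOL-Combinatorics.Combinatorics"
begin

definition laguerre :: "'a::field_char_0 \<Rightarrow> nat \<Rightarrow> 'a poly" where
  "laguerre \<alpha> n =
     (\<Sum>k\<le>n. monom (((of_nat n + \<alpha>) gchoose (n - k)) * (-1) ^ k / fact k) k)"

text \<open>The second summand is only meaningful for \<open>n \<ge> 1\<close>; at \<open>n = 0\<close> the subtraction truncates.\<close>

definition laguerre_pert :: "'a::field_char_0 \<Rightarrow> nat \<Rightarrow> 'a \<Rightarrow> 'a poly" where
  "laguerre_pert \<alpha> n c = laguerre \<alpha> n + smult c (laguerre \<alpha> (n - 1))"

text \<open>
  The roots are listed with multiplicity in an arbitrarily chosen order; the lemma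
  \<open>discriminant_eq\<close> below shows that the choice does not matter. The definition is intended for
  polynomials of degree at least 1: for constants the exponent \<open>2 * degree f - 2\<close> truncates to 0.
\<close>

definition discriminant :: "complex poly \<Rightarrow> complex" where
  "discriminant f =
     (let rs = (SOME rs. f = smult (lead_coeff f) (\<Prod>r\<leftarrow>rs. [:- r, 1:]))
      in lead_coeff f ^ (2 * degree f - 2) *
         (\<Prod>(i, j) | i < j \<and> j < length rs. (rs ! i - rs ! j)\<^sup>2))"

lemma prod_diff_squares_mset_cong:
  fixes rs ss :: "'a::comm_ring_1 list"
  assumes "mset rs = mset ss"
  shows "(\<Prod>(i, j) | i < j \<and> j < length rs. (rs ! i - rs ! j)\<^sup>2) =
         (\<Prod>(i, j) | i < j \<and> j < length ss. (ss ! i - ss ! j)\<^sup>2)"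
proof -
  define n where "n = length ss"
  obtain p where p: "p permutes {..<n}" and rs: "permute_list p ss = rs"
    using mset_eq_permutation[OF assms] unfolding n_def by blast
  have len: "length rs = n"
    using rs n_def by (metis length_permute_list)
  have nth: "rs ! i = ss ! p i" if "i < n" for i
    using permute_list_nth[of p ss i] p that rs n_def by simp
  have pin: "p i < n \<longleftrightarrow> i < n" for i
    using permutes_in_image[OF p, of i] by simp
  have inj: "inj p"
    using p by (rule permutes_inj)
  let ?P = "{(i, j). i < j \<and> j < n}"
  let ?g = "\<lambda>(i, j). (min (p i) (p j), max (p i) (p j))"
  have fin: "finite ?P"
    by (rule finite_subset[of _ "{..<n} \<times> {..<n}"]) auto
  have "inj_on ?g ?P"
  proof (rule inj_onI, clarify)
    fix i j i' j' assume *: "i < j" "i' < j'"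
      and eq: "min (p i) (p j) = min (p i') (p j')" "max (p i) (p j) = max (p i') (p j')"
    have "p i = p i' \<and> p j = p j' \<or> p i = p j' \<and> p j = p i'"
      using eq unfolding min_def max_def by (auto split: if_splits)
    thus "i = i' \<and> j = j'"
      using * inj by (auto simp: inj_eq)
  qed
  moreover have "?g ` ?P \<subseteq> ?P"
  proof
    fix x assume "x \<in> ?g ` ?P"
    then obtain i j where *: "i < j" "j < n" "x = (min (p i) (p j), max (p i) (p j))"
      by auto
    have "p i \<noteq> p j" "p i < n" "p j < n"
      using * inj pin by (auto simp: inj_eq)
    thus "x \<in> ?P"
      using * by (auto simp: min_def max_def)
  qed
  ultimately have bij: "bij_betw ?g ?P ?P"
    using fin by (simp add: bij_betw_def endo_inj_surj)
  have "(\<Prod>(i, j)\<in>?P. (ss ! i - ss ! j)\<^sup>2) =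
        (\<Prod>x\<in>?P. (\<lambda>(i, j). (ss ! i - ss ! j)\<^sup>2) (?g x))"
    by (rule prod.reindex_bij_betw[OF bij, symmetric])
  also have "\<dots> = (\<Prod>(i, j)\<in>?P. (rs ! i - rs ! j)\<^sup>2)"
  proof (rule prod.cong[OF refl])
    fix x assume "x \<in> ?P"
    then obtain i j where "x = (i, j)" "i < j" "j < n"
      by auto
    thus "(\<lambda>(i, j). (ss ! i - ss ! j)\<^sup>2) (?g x) = (\<lambda>(i, j). (rs ! i - rs ! j)\<^sup>2) x"
      by (auto simp: nth min_def max_def power2_commute)
  qed
  finally show ?thesis
    using len n_def by simp
qed

lemma discriminant_eq:
  assumes "f = smult a (\<Prod>r\<leftarrow>rs. [:- r, 1:])" "a \<noteq> 0"
  shows "discriminant f = a ^ (2 * length rs - 2) *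
           (\<Prod>(i, j) | i < j \<and> j < length rs. (rs ! i - rs ! j)\<^sup>2)"
proof -
  have monic: "lead_coeff (\<Prod>r\<leftarrow>xs. [:- r, 1:]) = 1" for xs :: "complex list"
    by (induction xs) (simp_all add: lead_coeff_mult del: mult_pCons_left)
  have proots: "proots (\<Prod>r\<leftarrow>xs. [:- r, 1:]) = mset xs" for xs :: "complex list"
  proof (induction xs)
    case (Cons x xs)
    have "(\<Prod>r\<leftarrow>xs. [:- r, 1:]) \<noteq> 0"
      using monic[of xs] by auto
    thus ?case
      using Cons by (simp add: proots_mult del: mult_pCons_left)
  qed simp
  have lc: "lead_coeff f = a"
    using assms monic[of rs] by simp
  have deg: "degree f = length rs"
    using assms by (simp add: proots flip: size_proots_complex)
  define ss where "ss = (SOME rs. f = smult (lead_coeff f) (\<Prod>r\<leftarrow>rs. [:- r, 1:]))"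
  have "f = smult (lead_coeff f) (\<Prod>r\<leftarrow>ss. [:- r, 1:])"
    unfolding ss_def by (rule someI[of _ rs]) (unfold lc, rule assms(1))
  hence "proots f = mset ss"
    using lc assms(2) by (metis proots proots_smult)
  moreover have "proots f = mset rs"
    using assms by (simp add: proots)
  ultimately have "mset ss = mset rs" by simp
  from prod_diff_squares_mset_cong[OF this] show ?thesis
    unfolding discriminant_def
    unfolding ss_def[symmetric] Let_def
    unfolding lc unfolding deg by simp
qed

end

theory Submission
  imports Defs
begin

text \<open>
  Let \<open>f = L\<^sub>n + c L\<^bsub>n-1\<^esub>\<close>, with leading coefficient \<open>a = (-1)\<^sup>n / n!\<close> and roots \<open>r\<close>. The proof follows
  Schur's method. Up to sign and a power of \<open>a\<close>, the discriminant is \<open>\<Prod>\<^sub>r f'(r)\<close>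
  (\<open>discriminant_pderiv\<close>). The ladder relations of the Laguerre polynomials give
  \<open>x f' = n (1 + c) f + (c x - (1 + c) w) L\<^bsub>n-1\<^esub>\<close> with \<open>w = n c + n + \<alpha>\<close>
  (\<open>x_times_pderiv_laguerre_pert\<close>), so at a root of \<open>f\<close> the derivative is, up to the factor \<open>1 / r\<close>,
  the product of \<open>L\<^bsub>n-1\<^esub>(r)\<close> and of a linear factor. Over all roots, the three pieces multiply out as
  follows.

  \<^item> The product of the roots is \<open>(-1)\<^sup>n f(0) / a\<close>, a constant times \<open>w\<close>.

  \<^item> The product of the linear factors is, up to a constant, \<open>c\<^sup>n f((1 + c) w / c)\<close>, and
    \<open>(1 + c) w / c\<close> is the point at which the theorem evaluates \<open>f\<close>.

  \<^item> The product of the \<open>L\<^bsub>n-1\<^esub>(r)\<close> is a resultant. It is independent of \<open>c\<close>, and Schur's recursion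
    computes it (\<open>prod_laguerre_over_roots\<close>).

  The quotient \<open>c\<^sup>n f((1 + c) w / c) / w\<close> is a polynomial in \<open>c\<close>, called \<open>disc_core\<close> below, and the
  discriminant is a constant multiple of it for every \<open>c\<close> (\<open>discriminant_laguerre_pert\<close>). At \<open>c = 0\<close>
  this follows from working with homogenised identities, and at \<open>w = 0\<close>, where \<open>0\<close> is a root of \<open>f\<close>,
  from dividing the derivative relation by \<open>x\<close> (\<open>prod_pderiv_over_roots\<close>). The values of the
  right-hand side near the exceptional \<open>c\<close> are then values of a polynomial, which gives the limits.
  The degree is \<open>2 (n - 1)\<close> because the coefficients at \<open>c\<^bsup>2n\<^esup>\<close> in the numerator cancel while
  those at \<open>c\<^bsup>2n-1\<^esup>\<close> do not (\<open>degree_disc_core\<close>).\<close>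

section \<open>Ladder relations for Laguerre polynomials\<close>

lemma coeff_laguerre:
  "coeff (laguerre \<alpha> n) k =
     (if k \<le> n then ((of_nat n + \<alpha>) gchoose (n - k)) * (-1) ^ k / fact k else 0)"
  by (auto simp: laguerre_def coeff_sum sum.delta)

lemma coeff_laguerre_pert:
  "coeff (laguerre_pert \<alpha> (Suc m) c) k = coeff (laguerre \<alpha> (Suc m)) k + c * coeff (laguerre \<alpha> m) k"
  by (simp add: laguerre_pert_def)

lemma laguerre_pert_0 [simp]: "laguerre_pert \<alpha> n 0 = laguerre \<alpha> n"
  by (simp add: laguerre_pert_def)

lemma laguerre_0 [simp]: "laguerre \<alpha> 0 = 1"
  by (simp add: laguerre_def)

text \<open>
  On coefficients this is the absorption identity for generalised binomials.\<close>

lemma x_times_pderiv_laguerre: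
  fixes \<alpha> :: "'a::field_char_0"
  shows "pCons 0 (pderiv (laguerre \<alpha> (Suc m))) =
           smult (of_nat (Suc m)) (laguerre \<alpha> (Suc m)) - smult (of_nat (Suc m) + \<alpha>) (laguerre \<alpha> m)"
proof (rule poly_eqI)
  fix k
  have lhs: "coeff (pCons 0 (pderiv (laguerre \<alpha> (Suc m)))) k = of_nat k * coeff (laguerre \<alpha> (Suc m)) k"
    by (cases k) (simp_all add: coeff_pderiv)
  have "of_nat k * coeff (laguerre \<alpha> (Suc m)) k =
          of_nat (Suc m) * coeff (laguerre \<alpha> (Suc m)) k - (of_nat (Suc m) + \<alpha>) * coeff (laguerre \<alpha> m) k"
  proof (cases "k \<le> m")
    case True
    then obtain j where m: "m = k + j"
      using le_Suc_ex by blast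
    define s :: 'a where "s = (-1) ^ k / fact k"
    define X where "X = ((of_nat (Suc m) + \<alpha>) gchoose Suc j)"
    define Y where "Y = ((of_nat m + \<alpha>) gchoose j)"
    have "of_nat (Suc j) * X = (of_nat (Suc m) + \<alpha>) * Y"
      using gbinomial_absorption[of j "of_nat (Suc m) + \<alpha>"] by (simp add: X_def Y_def add_ac)
    hence "(of_nat (Suc m) - of_nat k) * X * s = (of_nat (Suc m) + \<alpha>) * Y * s"
      by (simp add: m)
    hence "of_nat k * (X * s) = of_nat (Suc m) * (X * s) - (of_nat (Suc m) + \<alpha>) * (Y * s)"
      unfolding left_diff_distrib mult.assoc by (metis add_diff_cancel_left' diff_add_cancel)
    moreover have "Suc m - k = Suc j" "m - k = j" "k \<le> Suc m" "k \<le> m"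
      by (simp_all add: m)
    hence "coeff (laguerre \<alpha> (Suc m)) k = X * s" "coeff (laguerre \<alpha> m) k = Y * s"
      unfolding coeff_laguerre X_def Y_def s_def by (simp_all only: if_True times_divide_eq_right)
    ultimately show ?thesis by simp
  qed (auto simp: coeff_laguerre le_Suc_eq)
  thus "coeff (pCons 0 (pderiv (laguerre \<alpha> (Suc m)))) k =
          coeff (smult (of_nat (Suc m)) (laguerre \<alpha> (Suc m)) - smult (of_nat (Suc m) + \<alpha>) (laguerre \<alpha> m)) k"
    unfolding lhs by simp
qed

text \<open>
  On coefficients this is Pascal's rule. Together with the
  previous relation it expresses the derivatives of \<open>L\<^sub>n\<close> and \<open>L\<^bsub>n-1\<^esub>\<close> by these two polynomials
  themselves.\<close>

lemma pderiv_laguerre: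
  fixes \<alpha> :: "'a::field_char_0"
  shows "pderiv (laguerre \<alpha> m) = pderiv (laguerre \<alpha> (Suc m)) + laguerre \<alpha> m"
proof (rule poly_eqI)
  fix k
  show "coeff (pderiv (laguerre \<alpha> m)) k = coeff (pderiv (laguerre \<alpha> (Suc m)) + laguerre \<alpha> m) k"
  proof (cases "Suc k \<le> m")
    case True
    then obtain j where m: "m = Suc (k + j)"
      using le_Suc_ex[OF True] by auto
    define s :: 'a where "s = (-1) ^ Suc k / fact (Suc k)"
    define X where "X = ((of_nat m + \<alpha>) gchoose Suc j)"
    define Y where "Y = ((of_nat m + \<alpha>) gchoose j)"
    have X': "((of_nat (Suc m) + \<alpha>) gchoose Suc j) = Y + X"
      using gbinomial_Suc_Suc[of "of_nat m + \<alpha>" j] by (simp add: X_def Y_def add_ac)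
    have s': "(-1) ^ k / fact k = - of_nat (Suc k) * s"
      by (simp add: s_def fact_Suc divide_simps del: of_nat_Suc)
    have "Suc m - Suc k = Suc j" "m - Suc k = j" "m - k = Suc j" "Suc k \<le> Suc m" "Suc k \<le> m" "k \<le> m"
      by (simp_all add: m)
    hence "coeff (laguerre \<alpha> (Suc m)) (Suc k) = (Y + X) * s" "coeff (laguerre \<alpha> m) (Suc k) = Y * s"
          "coeff (laguerre \<alpha> m) k = X * (- of_nat (Suc k) * s)"
      unfolding coeff_laguerre X'[symmetric] s'[symmetric]
      by (simp_all only: if_True times_divide_eq_right X_def Y_def s_def)
    thus ?thesis
      unfolding coeff_pderiv coeff_add by (simp only:) (simp add: algebra_simps del: of_nat_Suc)
  next
    case False
    hence "k = m \<or> k > m" by linarith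
    thus ?thesis
      by (auto simp: coeff_pderiv coeff_laguerre fact_Suc simp del: of_nat_Suc)
  qed
qed

text \<open>
  This relation makes the discriminant of \<open>f\<close> a value of \<open>f\<close> itself: modulo
  \<open>f = L\<^sub>n + c L\<^bsub>n-1\<^esub>\<close>, the polynomial \<open>x f'\<close> is
  \<open>L\<^bsub>n-1\<^esub>\<close> times a factor that is only linear in \<open>x\<close>. The root of that factor is
  \<open>(1 + c) (n c + n + \<alpha>) / c = (n c\<^sup>2 + (2 n + \<alpha>) c + n + \<alpha>) / c\<close>, the point at which the
  discriminant formula evaluates \<open>f\<close>.\<close>

lemma x_times_pderiv_laguerre_pert:
  fixes \<alpha> :: "'a::field_char_0" and m :: nat
  defines "n \<equiv> Suc m"
  shows "pCons 0 (pderiv (laguerre_pert \<alpha> n c)) =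
           smult (of_nat n * (1 + c)) (laguerre_pert \<alpha> n c) +
           [:- ((1 + c) * (of_nat n * c + of_nat n + \<alpha>)), c:] * laguerre \<alpha> m"
proof (rule poly_ext)
  fix x
  have A: "x * poly (pderiv (laguerre \<alpha> n)) x =
             of_nat n * poly (laguerre \<alpha> n) x - (of_nat n + \<alpha>) * poly (laguerre \<alpha> m) x"
    using arg_cong[OF x_times_pderiv_laguerre[of \<alpha> m], of "\<lambda>p. poly p x"] by (simp add: n_def)
  have B: "poly (pderiv (laguerre \<alpha> m)) x = poly (pderiv (laguerre \<alpha> n)) x + poly (laguerre \<alpha> m) x"
    by (subst pderiv_laguerre) (simp add: n_def)
  have "x * (poly (pderiv (laguerre \<alpha> n)) x + c * poly (pderiv (laguerre \<alpha> m)) x) =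
          (1 + c) * (x * poly (pderiv (laguerre \<alpha> n)) x) + c * x * poly (laguerre \<alpha> m) x"
    unfolding B by (simp add: algebra_simps)
  also have "\<dots> = of_nat n * (1 + c) * (poly (laguerre \<alpha> n) x + c * poly (laguerre \<alpha> m) x) +
      (- ((1 + c) * (of_nat n * c + of_nat n + \<alpha>)) + x * c) * poly (laguerre \<alpha> m) x"
    unfolding A by (simp add: algebra_simps)
  finally have "x * (poly (pderiv (laguerre \<alpha> n)) x + c * poly (pderiv (laguerre \<alpha> m)) x) =
      of_nat n * (1 + c) * (poly (laguerre \<alpha> n) x + c * poly (laguerre \<alpha> m) x) +
      (- ((1 + c) * (of_nat n * c + of_nat n + \<alpha>)) + x * c) * poly (laguerre \<alpha> m) x" .
  moreover have "laguerre_pert \<alpha> n c = laguerre \<alpha> n + smult c (laguerre \<alpha> m)"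
    by (simp add: laguerre_pert_def n_def)
  ultimately show "poly (pCons 0 (pderiv (laguerre_pert \<alpha> n c))) x =
      poly (smult (of_nat n * (1 + c)) (laguerre_pert \<alpha> n c) +
           [:- ((1 + c) * (of_nat n * c + of_nat n + \<alpha>)), c:] * laguerre \<alpha> m) x"
    by (simp only: pderiv_add pderiv_smult poly_pCons poly_add poly_smult poly_mult poly_0) simp
qed

lemma degree_laguerre_pert: "degree (laguerre_pert \<alpha> (Suc m) c) = Suc m"
proof (rule antisym)
  show "degree (laguerre_pert \<alpha> (Suc m) c) \<le> Suc m"
    by (rule degree_le) (auto simp: coeff_laguerre_pert coeff_laguerre)
  show "Suc m \<le> degree (laguerre_pert \<alpha> (Suc m) c)"
    by (rule le_degree) (simp add: coeff_laguerre_pert coeff_laguerre del: of_nat_Suc fact_Suc)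
qed

lemma lead_coeff_laguerre_pert:
  "lead_coeff (laguerre_pert \<alpha> (Suc m) c) = (-1) ^ Suc m / fact (Suc m)"
  unfolding degree_laguerre_pert by (simp add: coeff_laguerre_pert coeff_laguerre)

lemma poly_laguerre_0:
  "poly (laguerre \<alpha> n) 0 = (\<Prod>k=1..n. of_nat k + \<alpha>) / fact n"
proof -
  have "poly (laguerre \<alpha> n) 0 = pochhammer (\<alpha> + 1) n / fact n"
    by (simp add: poly_0_coeff_0 coeff_laguerre gbinomial_pochhammer' add_ac)
  also have "pochhammer (\<alpha> + 1) n = (\<Prod>k=1..n. of_nat k + \<alpha>)"
    by (induction n) (simp_all add: pochhammer_rec' add_ac mult_ac)
  finally show ?thesis .
qed

text \<open>
  The product of the roots of \<open>f\<close> vanishes exactly with \<open>n c + n + \<alpha>\<close> when \<open>L\<^bsub>n-1\<^esub>(0) \<noteq> 0\<close>; this is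
  the origin of the denominator in the discriminant formula.\<close>

lemma poly_laguerre_pert_0:
  fixes \<alpha> :: "'a::field_char_0"
  shows "of_nat (Suc m) * poly (laguerre_pert \<alpha> (Suc m) c) 0 =
           (of_nat (Suc m) * c + of_nat (Suc m) + \<alpha>) * poly (laguerre \<alpha> m) 0"
proof -
  have "of_nat (Suc m) * poly (laguerre \<alpha> (Suc m)) 0 = (of_nat (Suc m) + \<alpha>) * poly (laguerre \<alpha> m) 0"
    by (simp add: poly_laguerre_0 field_simps del: of_nat_Suc)
  thus ?thesis
    by (simp add: laguerre_pert_def algebra_simps)
qed

section \<open>Products over root lists\<close>

lemma poly_root_list: "poly (\<Prod>r\<leftarrow>rs. [:- r, 1:]) x = (\<Prod>r\<leftarrow>rs. x - r)" for x :: "'a::comm_ring_1"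
  by (induction rs) (simp_all add: algebra_simps)

lemma poly_root_list_complex_ex:
  fixes f :: "complex poly"
  assumes "f \<noteq> 0"
  obtains rs where "f = smult (lead_coeff f) (\<Prod>r\<leftarrow>rs. [:- r, 1:])" "length rs = degree f"
proof -
  obtain A where A: "size A = degree f" "f = smult (lead_coeff f) (\<Prod>x\<in>#A. [:- x, 1:])"
    using alg_closed_imp_factorization[OF assms] by blast
  obtain rs where "mset rs = A" using ex_mset by blast
  hence "f = smult (lead_coeff f) (\<Prod>r\<leftarrow>rs. [:- r, 1:])" "length rs = degree f"
    using A by (auto simp flip: prod_mset_prod_list)
  thus ?thesis by (rule that)
qed

lemma prod_list_mult:
  "(\<Prod>x\<leftarrow>xs. f x * g x) = (\<Prod>x\<leftarrow>xs. f x) * (\<Prod>x\<leftarrow>xs. g x)" for f g :: "'b \<Rightarrow> 'a::comm_monoid_mult"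
  by (induction xs) (simp_all add: mult_ac)

text \<open>
  Reciprocity of resultants: both sides are powers of the leading coefficients times
  \<open>\<Prod>\<^sub>r\<Prod>\<^sub>s (r - s)\<close>.\<close>

lemma poly_prod_over_roots_swap:
  fixes f g :: "'a::comm_ring_1 poly"
  assumes f: "f = smult a (\<Prod>r\<leftarrow>rs. [:- r, 1:])" and g: "g = smult b (\<Prod>s\<leftarrow>ss. [:- s, 1:])"
  shows "a ^ length ss * (\<Prod>r\<leftarrow>rs. poly g r) =
           (-1) ^ (length rs * length ss) * b ^ length rs * (\<Prod>s\<leftarrow>ss. poly f s)"
proof -
  have neg: "(\<Prod>r\<leftarrow>rs. s - r) = (-1) ^ length rs * (\<Prod>r\<leftarrow>rs. r - s)" for s :: 'a
    by (induction rs) (simp_all add: algebra_simps)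
  have "(\<Prod>s\<leftarrow>ss. poly f s) = a ^ length ss * (\<Prod>s\<leftarrow>ss. \<Prod>r\<leftarrow>rs. s - r)"
    unfolding f by (induction ss) (simp_all add: poly_root_list mult_ac)
  also have "(\<Prod>s\<leftarrow>ss. \<Prod>r\<leftarrow>rs. s - r) = (-1) ^ (length rs * length ss) * (\<Prod>s\<leftarrow>ss. \<Prod>r\<leftarrow>rs. r - s)"
    by (subst neg, induction ss) (simp_all add: power_add mult_ac)
  also have "(\<Prod>s\<leftarrow>ss. \<Prod>r\<leftarrow>rs. r - s) = (\<Prod>r\<leftarrow>rs. \<Prod>s\<leftarrow>ss. r - s)"
    by (induction ss) (simp_all add: prod_list_mult map_replicate_const)
  finally have 1: "(\<Prod>s\<leftarrow>ss. poly f s) =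
      a ^ length ss * ((-1) ^ (length rs * length ss) * (\<Prod>r\<leftarrow>rs. \<Prod>s\<leftarrow>ss. r - s))" .
  have 2: "(\<Prod>r\<leftarrow>rs. poly g r) = b ^ length rs * (\<Prod>r\<leftarrow>rs. \<Prod>s\<leftarrow>ss. r - s)"
    unfolding g by (induction rs) (simp_all add: poly_root_list mult_ac)
  \<comment> \<open>The sign is its own inverse, so it may be moved to the other side.\<close>
  have "(-1) ^ (length rs * length ss) * (-1) ^ (length rs * length ss) = (1::'a)"
    by (simp flip: power_mult_distrib)
  thus ?thesis unfolding 1 2 by (simp add: mult_ac)
qed

lemma degree_root_list: "degree (\<Prod>r\<leftarrow>rs. [:- r, 1:]) = length rs"
  and lead_coeff_root_list: "lead_coeff (\<Prod>r\<leftarrow>rs. [:- r, 1:]) = 1" for rs :: "'a::field list"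
proof -
  have "degree (\<Prod>r\<leftarrow>rs. [:- r, 1:]) = length rs \<and> lead_coeff (\<Prod>r\<leftarrow>rs. [:- r, 1:]) = 1"
  proof (induction rs)
    case (Cons r rs)
    hence "(\<Prod>r\<leftarrow>rs. [:- r, 1:]) \<noteq> 0" by auto
    hence "degree ([:- r, 1:] * (\<Prod>r\<leftarrow>rs. [:- r, 1:])) = Suc (length rs)"
      using Cons by (simp add: degree_mult_eq del: mult_pCons_left)
    moreover have "lead_coeff ([:- r, 1:] * (\<Prod>r\<leftarrow>rs. [:- r, 1:])) = 1"
      by (subst lead_coeff_mult) (simp add: Cons.IH[THEN conjunct2])
    ultimately show ?case by simp
  qed simp
  thus "degree (\<Prod>r\<leftarrow>rs. [:- r, 1:]) = length rs" "lead_coeff (\<Prod>r\<leftarrow>rs. [:- r, 1:]) = 1"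
    by blast+
qed

text \<open>
  The two-variable form of \<open>f (u / v)\<close>. With the denominator cleared the identity stays valid at
  \<open>v = 0\<close>; it is used with \<open>v = c\<close> and thereby covers \<open>c = 0\<close>.\<close>

lemma prod_root_list_homogeneous:
  fixes f :: "'a::field poly"
  assumes f: "f = smult a (\<Prod>r\<leftarrow>rs. [:- r, 1:])" and len: "length rs = n"
  shows "a * (\<Prod>r\<leftarrow>rs. u - v * r) = (\<Sum>k\<le>n. coeff f k * u ^ k * v ^ (n - k))"
proof (cases "v = 0")
  case True
  have "(\<Sum>k\<le>n. coeff f k * u ^ k * v ^ (n - k)) = (\<Sum>k\<le>n. if k = n then coeff f k * u ^ k else 0)"
    by (intro sum.cong) (auto simp: True)
  also have "\<dots> = coeff f n * u ^ n"
    by simp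
  also have "coeff f n = a"
    using degree_root_list[of rs] lead_coeff_root_list[of rs] by (simp add: f len)
  finally show ?thesis
    using len by (simp add: True map_replicate_const)
next
  case False
  have "degree f \<le> n"
    using degree_root_list[of rs] by (simp add: f len)
  hence "poly f (u / v) = (\<Sum>k\<le>n. coeff f k * (u / v) ^ k)"
    unfolding poly_altdef by (intro sum.mono_neutral_left) (auto simp: coeff_eq_0)
  hence "v ^ n * poly f (u / v) = (\<Sum>k\<le>n. v ^ n * (coeff f k * (u / v) ^ k))"
    by (simp add: sum_distrib_left)
  also have "\<dots> = (\<Sum>k\<le>n. coeff f k * u ^ k * v ^ (n - k))"
    using False by (intro sum.cong) (auto simp: power_diff power_divide)
  finally have 1: "v ^ n * poly f (u / v) = (\<Sum>k\<le>n. coeff f k * u ^ k * v ^ (n - k))" .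
  have "(\<Prod>r\<leftarrow>rs. u - v * r) = v ^ length rs * (\<Prod>r\<leftarrow>rs. u / v - r)"
    using False by (induction rs) (simp_all add: field_simps)
  moreover have "poly f (u / v) = a * (\<Prod>r\<leftarrow>rs. u / v - r)"
    by (simp add: f poly_root_list)
  ultimately show ?thesis
    unfolding 1[symmetric] by (simp add: len)
qed

section \<open>The resultant of consecutive Laguerre polynomials\<close>

lemma laguerre_pert_root_list_ex:
  fixes \<alpha> c :: complex
  obtains rs where "laguerre_pert \<alpha> (Suc m) c = smult ((-1) ^ Suc m / fact (Suc m)) (\<Prod>r\<leftarrow>rs. [:- r, 1:])"
    "length rs = Suc m"
proof -
  have "laguerre_pert \<alpha> (Suc m) c \<noteq> 0"
    using degree_laguerre_pert[of \<alpha> m c] by auto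
  from poly_root_list_complex_ex[OF this] show ?thesis
    using that unfolding lead_coeff_laguerre_pert unfolding degree_laguerre_pert by blast
qed

text \<open>
  At a root \<open>s\<close> of \<open>L\<^sub>M\<close> with \<open>M = m + 1\<close> the three-term recurrence loses its middle term. It follows
  by computing \<open>s L\<^sub>M'(s) = s L\<^bsub>M+1\<^esub>'(s)\<close> in two ways with the ladder relations.\<close>

lemma laguerre_at_root:
  assumes "poly (laguerre \<alpha> (Suc m)) s = 0"
  shows "of_nat (Suc (Suc m)) * poly (laguerre \<alpha> (Suc (Suc m))) s =
           - ((of_nat (Suc m) + \<alpha>) * poly (laguerre \<alpha> m) s)"
  using arg_cong[OF x_times_pderiv_laguerre[of \<alpha> m], of "\<lambda>p. poly p s"]
    arg_cong[OF x_times_pderiv_laguerre[of \<alpha> "Suc m"], of "\<lambda>p. poly p s"]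
    arg_cong[OF pderiv_laguerre[of \<alpha> "Suc m"], of "\<lambda>p. poly p s"] assms
  by (simp del: of_nat_Suc)

lemma prod_list_cmult: "(\<Prod>x\<leftarrow>xs. c * f x) = c ^ length xs * (\<Prod>x\<leftarrow>xs. f x)" for c :: "'a::comm_monoid_mult"
  by (simp add: prod_list_mult map_replicate_const)

text \<open>
  Schur's recursion. By reciprocity the product over the roots of \<open>L\<^sub>n + c L\<^bsub>n-1\<^esub>\<close> becomes a product
  over the roots of \<open>L\<^bsub>n-1\<^esub>\<close>, where the term with \<open>c\<close> vanishes and \<open>L\<^sub>n\<close> is a multiple of \<open>L\<^bsub>n-2\<^esub>\<close>;
  that is the same product one degree lower, at \<open>c = 0\<close>. In particular the value does not depend
  on \<open>c\<close>.\<close>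

lemma prod_laguerre_over_roots:
  fixes \<alpha> c :: complex
  assumes "laguerre_pert \<alpha> (Suc m) c = smult ((-1) ^ Suc m / fact (Suc m)) (\<Prod>r\<leftarrow>rs. [:- r, 1:])"
    and "length rs = Suc m"
  shows "(\<Prod>r\<leftarrow>rs. poly (laguerre \<alpha> m) r) = (\<Prod>k=1..m. (-1) ^ k * (of_nat k + \<alpha>) ^ k / fact k)"
  using assms
proof (induction m arbitrary: c rs)
  case 0
  thus ?case by (simp add: map_replicate_const)
next
  case (Suc m)
  define M where "M = Suc m"
  define n where "n = Suc M"
  define a b :: complex where "a = (-1) ^ n / fact n" and "b = (-1) ^ M / fact M"
  define f where "f = laguerre_pert \<alpha> n c"
  obtain ss where ss: "laguerre_pert \<alpha> (Suc m) 0 = smult ((-1) ^ Suc m / fact (Suc m)) (\<Prod>s\<leftarrow>ss. [:- s, 1:])"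
      "length ss = Suc m"
    by (rule laguerre_pert_root_list_ex)
  note IH = Suc.IH[OF ss]
  have g: "laguerre \<alpha> M = smult b (\<Prod>s\<leftarrow>ss. [:- s, 1:])"
    using ss by (simp add: M_def b_def)
  have f: "f = smult a (\<Prod>r\<leftarrow>rs. [:- r, 1:])" and len: "length rs = n" "length ss = M"
    using Suc.prems ss unfolding f_def a_def n_def M_def by blast+
  have fs: "poly f s = (- (of_nat M + \<alpha>) / of_nat n) * poly (laguerre \<alpha> m) s" if "s \<in> set ss" for s
  proof -
    have 0: "poly (laguerre \<alpha> M) s = 0"
      using that by (simp add: g poly_root_list prod_list_zero_iff)
    hence "of_nat n * poly (laguerre \<alpha> n) s = - ((of_nat M + \<alpha>) * poly (laguerre \<alpha> m) s)"
      unfolding n_def M_def by (rule laguerre_at_root)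
    moreover have "(of_nat n :: complex) \<noteq> 0"
      by (simp add: n_def del: of_nat_Suc)
    moreover have "poly f s = poly (laguerre \<alpha> n) s"
      using 0 by (simp add: f_def n_def laguerre_pert_def)
    ultimately show ?thesis
      by (simp add: field_simps)
  qed
  have "(\<Prod>s\<leftarrow>ss. poly f s) = (\<Prod>s\<leftarrow>ss. (- (of_nat M + \<alpha>) / of_nat n) * poly (laguerre \<alpha> m) s)"
    using fs by (metis (no_types, lifting) map_eq_conv)
  also have "\<dots> = (- (of_nat M + \<alpha>) / of_nat n) ^ M * (\<Prod>s\<leftarrow>ss. poly (laguerre \<alpha> m) s)"
    by (simp only: prod_list_cmult len)
  finally have fss: "(\<Prod>s\<leftarrow>ss. poly f s) =
      (- (of_nat M + \<alpha>) / of_nat n) ^ M * (\<Prod>s\<leftarrow>ss. poly (laguerre \<alpha> m) s)" .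
  have "a ^ M * (\<Prod>r\<leftarrow>rs. poly (laguerre \<alpha> M) r) = (-1) ^ (n * M) * b ^ n * (\<Prod>s\<leftarrow>ss. poly f s)"
    using poly_prod_over_roots_swap[OF f g] by (simp add: len)
  \<comment> \<open>One of two consecutive degrees is even.\<close>
  also have "(-1) ^ (n * M) = (1 :: complex)"
    by (simp add: n_def)
  also have "1 * b ^ n * (\<Prod>s\<leftarrow>ss. poly f s) =
      b * (b * (- (of_nat M + \<alpha>) / of_nat n)) ^ M * (\<Prod>s\<leftarrow>ss. poly (laguerre \<alpha> m) s)"
    unfolding fss power_mult_distrib by (simp add: n_def)
  also have "b * (- (of_nat M + \<alpha>) / of_nat n) = a * (of_nat M + \<alpha>)"
    by (simp add: a_def b_def n_def divide_simps del: of_nat_Suc) (simp add: algebra_simps)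
  finally have "a ^ M * (\<Prod>r\<leftarrow>rs. poly (laguerre \<alpha> M) r) =
      a ^ M * (b * (of_nat M + \<alpha>) ^ M * (\<Prod>s\<leftarrow>ss. poly (laguerre \<alpha> m) s))"
    by (simp only: power_mult_distrib mult_ac)
  moreover have "a \<noteq> 0" by (simp add: a_def)
  ultimately have "(\<Prod>r\<leftarrow>rs. poly (laguerre \<alpha> M) r) =
      b * (of_nat M + \<alpha>) ^ M * (\<Prod>s\<leftarrow>ss. poly (laguerre \<alpha> m) s)"
    by simp
  thus ?case
    unfolding IH b_def M_def by (simp add: prod.nat_ivl_Suc' del: of_nat_Suc fact_Suc power_Suc)
qed

section \<open>The discriminant as a product of derivatives at the roots\<close>

text \<open>
  Each unordered pair of distinct indices occurs in both orders.\<close>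

lemma prod_off_diagonal:
  fixes g :: "nat \<Rightarrow> nat \<Rightarrow> 'a::comm_monoid_mult"
  shows "(\<Prod>i<n. \<Prod>j\<in>{..<n} - {i}. g i j) = (\<Prod>j<n. \<Prod>i<j. g i j * g j i)"
proof (induction n)
  case (Suc n)
  have "(\<Prod>i<Suc n. \<Prod>j\<in>{..<Suc n} - {i}. g i j) =
          (\<Prod>i<n. \<Prod>j\<in>{..<Suc n} - {i}. g i j) * (\<Prod>j\<in>{..<Suc n} - {n}. g n j)"
    by simp
  also have "{..<Suc n} - {n} = {..<n}"
    by auto
  also have "(\<Prod>i<n. \<Prod>j\<in>{..<Suc n} - {i}. g i j) = (\<Prod>i<n. g i n * (\<Prod>j\<in>{..<n} - {i}. g i j))"
  proof (rule prod.cong[OF refl])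
    fix i assume "i \<in> {..<n}"
    hence "{..<Suc n} - {i} = insert n ({..<n} - {i})" by auto
    thus "(\<Prod>j\<in>{..<Suc n} - {i}. g i j) = g i n * (\<Prod>j\<in>{..<n} - {i}. g i j)"
      by simp
  qed
  finally show ?case
    using Suc.IH by (simp add: prod.distrib mult_ac)
qed simp

lemma prod_pairs_less:
  fixes h :: "nat \<Rightarrow> nat \<Rightarrow> 'a::comm_monoid_mult"
  shows "(\<Prod>(i, j) | i < j \<and> j < n. h i j) = (\<Prod>j<n. \<Prod>i<j. h i j)"
proof -
  have "(\<Prod>j<n. \<Prod>i<j. h i j) = (\<Prod>(j, i)\<in>Sigma {..<n} (\<lambda>j. {..<j}). h i j)"
    by (rule prod.Sigma) auto
  also have "\<dots> = (\<Prod>(i, j) | i < j \<and> j < n. h i j)"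
    by (rule prod.reindex_bij_witness[of _ "\<lambda>(i, j). (j, i)" "\<lambda>(i, j). (j, i)"]) auto
  finally show ?thesis ..
qed

lemma pderiv_at_root:
  fixes x :: "'i \<Rightarrow> 'a::idom"
  assumes "finite I" "i \<in> I"
  shows "poly (pderiv (smult a (\<Prod>j\<in>I. [:- x j, 1:]))) (x i) = a * (\<Prod>j\<in>I - {i}. x i - x j)"
  using assms by (simp add: prod.remove[of I i] pderiv_smult pderiv_mult pderiv_pCons poly_prod del: mult_pCons_left)

text \<open>
  Since \<open>f'(r\<^sub>i) = a \<Prod>\<^bsub>j\<noteq>i\<^esub> (r\<^sub>i - r\<^sub>j)\<close>, multiplying over all roots gives each squared difference
  with a sign; the index \<open>j\<close> is the larger one in \<open>j\<close> pairs, which accounts for the sign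
  \<open>\<Prod>\<^bsub>j<n\<^esub> (-1)\<^sup>j\<close>. Keeping \<open>a ^ n\<close> on the left avoids the exponent \<open>n - 2\<close>, which would
  truncate at \<open>n = 1\<close>.\<close>

lemma discriminant_pderiv:
  assumes f: "f = smult a (\<Prod>r\<leftarrow>rs. [:- r, 1:])" and "a \<noteq> 0" and len: "length rs = n"
  shows "a ^ n * discriminant f =
           a ^ (2 * n - 2) * (\<Prod>j<n. (-1) ^ j) * (\<Prod>r\<leftarrow>rs. poly (pderiv f) r)"
proof -
  have f': "f = smult a (\<Prod>j\<in>{..<n}. [:- (rs ! j), 1:])"
    unfolding f by (simp add: prod.list_conv_set_nth len atLeast0LessThan)
  have "(\<Prod>r\<leftarrow>rs. poly (pderiv f) r) = (\<Prod>i<n. poly (pderiv f) (rs ! i))"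
    by (simp add: prod.list_conv_set_nth len atLeast0LessThan)
  also have "\<dots> = (\<Prod>i<n. a * (\<Prod>j\<in>{..<n} - {i}. rs ! i - rs ! j))"
    unfolding f' by (intro prod.cong refl pderiv_at_root) auto
  also have "\<dots> = a ^ n * (\<Prod>i<n. \<Prod>j\<in>{..<n} - {i}. rs ! i - rs ! j)"
    by (simp add: prod.distrib)
  also have "(\<Prod>i<n. \<Prod>j\<in>{..<n} - {i}. rs ! i - rs ! j) =
      (\<Prod>j<n. \<Prod>i<j. (rs ! i - rs ! j) * (rs ! j - rs ! i))"
    by (rule prod_off_diagonal)
  also have "\<dots> = (\<Prod>j<n. \<Prod>i<j. - 1 * (rs ! i - rs ! j)\<^sup>2)"
    by (intro prod.cong refl) (simp add: power2_eq_square algebra_simps)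
  also have "\<dots> = (\<Prod>j<n. (-1) ^ j) * (\<Prod>j<n. \<Prod>i<j. (rs ! i - rs ! j)\<^sup>2)"
    by (simp only: prod.distrib prod_constant card_lessThan)
  also have "(\<Prod>j<n. \<Prod>i<j. (rs ! i - rs ! j)\<^sup>2) = (\<Prod>(i, j) | i < j \<and> j < length rs. (rs ! i - rs ! j)\<^sup>2)"
    by (simp add: prod_pairs_less len)
  finally have 1: "(\<Prod>r\<leftarrow>rs. poly (pderiv f) r) =
      a ^ n * ((\<Prod>j<n. (-1) ^ j) * (\<Prod>(i, j) | i < j \<and> j < length rs. (rs ! i - rs ! j)\<^sup>2))" .
  have "(\<Prod>j<n. (-1) ^ j) * (\<Prod>j<n. (-1) ^ j) = (1 :: complex)"
    by (simp flip: prod.distrib power_mult_distrib)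
  thus ?thesis
    unfolding discriminant_eq[OF f \<open>a \<noteq> 0\<close>] 1 len by (simp add: mult_ac)
qed

section \<open>The discriminant polynomial up to a constant\<close>

text \<open>
  With \<open>n = m + 1\<close>, \<open>W = n c + n + \<alpha>\<close> and \<open>f = L\<^sub>n + c L\<^bsub>n-1\<^esub>\<close>, this is the polynomial in \<open>c\<close> that equals
  \<open>c ^ n f ((1 + c) W / c) / W\<close> for \<open>c \<noteq> 0\<close>, \<open>W \<noteq> 0\<close>. Both singularities are removed in the
  definition: the powers of \<open>c\<close> are multiplied out term by term, and \<open>W\<close> is divided out of each
  term, where the constant coefficient of \<open>f\<close> is \<open>W L\<^bsub>n-1\<^esub>(0) / n\<close> and every other term contains
  a positive power of \<open>(1 + c) W\<close>. When \<open>L\<^bsub>n-1\<^esub>(0) \<noteq> 0\<close>, it is the discriminant of \<open>f\<close> up to a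
  constant factor.\<close>

definition disc_core :: "'a::field_char_0 \<Rightarrow> nat \<Rightarrow> 'a poly" where
  "disc_core \<alpha> m =
     (\<Sum>k\<le>m. [:coeff (laguerre \<alpha> (Suc m)) (Suc k), coeff (laguerre \<alpha> m) (Suc k):] * [:1, 1:] *
              ([:1, 1:] * [:of_nat (Suc m) + \<alpha>, of_nat (Suc m):]) ^ k * monom 1 (m - k)) +
     monom (poly (laguerre \<alpha> m) 0 / of_nat (Suc m)) (Suc m)"

lemma linear_times_disc_core:
  fixes \<alpha> :: "'a::field_char_0" and m :: nat
  defines "n \<equiv> Suc m"
  defines "W \<equiv> [:of_nat n + \<alpha>, of_nat n:]"
  shows "W * disc_core \<alpha> m =
           (\<Sum>k\<le>n. [:coeff (laguerre \<alpha> n) k, coeff (laguerre \<alpha> m) k:] * ([:1, 1:] * W) ^ k * monom 1 (n - k))"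
proof -
  define B where "B = poly (laguerre \<alpha> m) 0"
  have nz: "(of_nat n :: 'a) \<noteq> 0"
    by (simp add: n_def del: of_nat_Suc)
  have m0: "coeff (laguerre \<alpha> m) 0 = B"
    by (simp add: B_def poly_0_coeff_0)
  have "of_nat n * coeff (laguerre \<alpha> n) 0 = (of_nat n + \<alpha>) * B"
    using poly_laguerre_pert_0[of m \<alpha> 0] by (simp add: n_def B_def poly_0_coeff_0)
  hence "[:coeff (laguerre \<alpha> n) 0, coeff (laguerre \<alpha> m) 0:] = smult (B / of_nat n) W"
    using nz by (simp add: W_def m0 field_simps)
  hence "(\<Sum>k\<le>n. [:coeff (laguerre \<alpha> n) k, coeff (laguerre \<alpha> m) k:] * ([:1, 1:] * W) ^ k * monom 1 (n - k)) =
      smult (B / of_nat n) W * monom 1 n +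
      (\<Sum>k\<le>m. [:coeff (laguerre \<alpha> n) (Suc k), coeff (laguerre \<alpha> m) (Suc k):] * ([:1, 1:] * W) ^ Suc k * monom 1 (m - k))"
    unfolding n_def by (subst sum.atMost_Suc_shift) (simp del: of_nat_Suc mult_pCons_left mult_pCons_right power_Suc)
  also have "smult (B / of_nat n) W * monom 1 n = W * monom (B / of_nat n) n"
    by (simp add: smult_monom flip: mult_smult_right)
  also have "(\<Sum>k\<le>m. [:coeff (laguerre \<alpha> n) (Suc k), coeff (laguerre \<alpha> m) (Suc k):] * ([:1, 1:] * W) ^ Suc k * monom 1 (m - k)) =
      W * (\<Sum>k\<le>m. [:coeff (laguerre \<alpha> n) (Suc k), coeff (laguerre \<alpha> m) (Suc k):] * [:1, 1:] * ([:1, 1:] * W) ^ k * monom 1 (m - k))"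
    unfolding sum_distrib_left by (intro sum.cong refl) (simp only: power_Suc mult_ac)
  finally show ?thesis
    unfolding disc_core_def n_def[symmetric] W_def[symmetric] B_def[symmetric]
    by (simp only: distrib_left add_ac)
qed

lemma poly_disc_core:
  fixes \<alpha> c :: "'a::field_char_0" and m :: nat
  defines "n \<equiv> Suc m"
  defines "w \<equiv> of_nat n * c + of_nat n + \<alpha>"
  shows "w * poly (disc_core \<alpha> m) c =
           (\<Sum>k\<le>n. coeff (laguerre_pert \<alpha> n c) k * ((1 + c) * w) ^ k * c ^ (n - k))"
proof -
  have w: "poly [:of_nat n + \<alpha>, of_nat n:] c = w"
    by (simp add: w_def algebra_simps)
  have "w * poly (disc_core \<alpha> m) c = poly ([:of_nat n + \<alpha>, of_nat n:] * disc_core \<alpha> m) c"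
    by (simp only: poly_mult w)
  also have "\<dots> = (\<Sum>k\<le>n. coeff (laguerre_pert \<alpha> n c) k * ((1 + c) * w) ^ k * c ^ (n - k))"
    unfolding n_def linear_times_disc_core
    unfolding n_def[symmetric] poly_sum poly_mult poly_power poly_monom w
    by (intro sum.cong refl) (simp add: n_def coeff_laguerre_pert)
  finally show ?thesis .
qed

text \<open>
  For \<open>w = n c + n + \<alpha> \<noteq> 0\<close> one multiplies the derivative relation over all roots; the linear factors
  give the core polynomial by homogenisation, and the product of the roots cancels against \<open>w\<close>.
  For \<open>w = 0\<close> this cancellation is impossible because \<open>0\<close> is a root, and one argues with the
  quotient \<open>f / x\<close>: the derivative relation can then be divided by \<open>x\<close>, and it gives \<open>f'\<close> at the
  root \<open>0\<close> as well.\<close>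

lemma prod_pderiv_over_roots:
  fixes \<alpha> c :: complex and m :: nat
  defines "n \<equiv> Suc m"
  defines "f \<equiv> laguerre_pert \<alpha> n c"
  assumes f: "f = smult a (\<Prod>r\<leftarrow>rs. [:- r, 1:])" and len: "length rs = n"
  shows "poly (laguerre \<alpha> m) 0 * (\<Prod>r\<leftarrow>rs. poly (pderiv f) r) =
           of_nat n * poly (disc_core \<alpha> m) c * (\<Prod>r\<leftarrow>rs. poly (laguerre \<alpha> m) r)"
proof -
  define B where "B = poly (laguerre \<alpha> m) 0"
  define w where "w = of_nat n * c + of_nat n + \<alpha>"
  define S where "S = (\<Prod>r\<leftarrow>rs. poly (laguerre \<alpha> m) r)"
  have nz: "(of_nat n :: complex) \<noteq> 0"
    by (simp add: n_def del: of_nat_Suc)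
  have f0: "of_nat n * poly f 0 = w * B"
    using poly_laguerre_pert_0[of m \<alpha> c] by (simp add: n_def f_def B_def w_def)
  have deriv: "pCons 0 (pderiv f) = smult (of_nat n * (1 + c)) f + [:- ((1 + c) * w), c:] * laguerre \<alpha> m"
    unfolding f_def n_def w_def by (rule x_times_pderiv_laguerre_pert)
  have "B * (\<Prod>r\<leftarrow>rs. poly (pderiv f) r) = of_nat n * poly (disc_core \<alpha> m) c * S"
  proof (cases "w = 0")
    case False
    have root: "r * poly (pderiv f) r = (- 1) * (((1 + c) * w - c * r) * poly (laguerre \<alpha> m) r)"
      if "r \<in> set rs" for r
    proof -
      have "poly f r = 0"
        using that by (simp add: f poly_root_list prod_list_zero_iff)
      thus ?thesis
        using arg_cong[OF deriv, of "\<lambda>p. poly p r"] by (simp add: algebra_simps)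
    qed
    have "(\<Prod>r\<leftarrow>rs. r) * (\<Prod>r\<leftarrow>rs. poly (pderiv f) r) =
        (\<Prod>r\<leftarrow>rs. (- 1) * (((1 + c) * w - c * r) * poly (laguerre \<alpha> m) r))"
      unfolding prod_list_mult[symmetric] using root by (metis (no_types, lifting) map_eq_conv)
    also have "\<dots> = (- 1) ^ n * ((\<Prod>r\<leftarrow>rs. (1 + c) * w - c * r) * S)"
      by (simp only: prod_list_cmult len) (simp only: prod_list_mult S_def)
    finally have 1: "(\<Prod>r\<leftarrow>rs. r) * (\<Prod>r\<leftarrow>rs. poly (pderiv f) r) =
        (- 1) ^ n * ((\<Prod>r\<leftarrow>rs. (1 + c) * w - c * r) * S)" .
    have 2: "a * (\<Prod>r\<leftarrow>rs. (1 + c) * w - c * r) = w * poly (disc_core \<alpha> m) c"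
      unfolding prod_root_list_homogeneous[OF f len] w_def f_def n_def by (rule poly_disc_core[symmetric])
    have "poly f 0 = a * (\<Prod>r\<leftarrow>rs. (- 1) * r)"
      by (simp add: f poly_root_list)
    hence "poly f 0 = a * ((- 1) ^ n * (\<Prod>r\<leftarrow>rs. r))"
      by (simp only: prod_list_cmult len)
    hence "w * (B * (\<Prod>r\<leftarrow>rs. poly (pderiv f) r)) =
        of_nat n * a * (- 1) ^ n * ((\<Prod>r\<leftarrow>rs. r) * (\<Prod>r\<leftarrow>rs. poly (pderiv f) r))"
      unfolding mult.assoc[symmetric] f0[symmetric] by simp
    also have "\<dots> = ((- 1) ^ n * (- 1) ^ n) * of_nat n * (a * (\<Prod>r\<leftarrow>rs. (1 + c) * w - c * r)) * S"
      unfolding 1 by (simp only: mult_ac)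
    also have "(- 1) ^ n * (- 1) ^ n = (1 :: complex)"
      by (simp flip: power_mult_distrib)
    finally have "w * (B * (\<Prod>r\<leftarrow>rs. poly (pderiv f) r)) = w * (of_nat n * poly (disc_core \<alpha> m) c * S)"
      unfolding 2 by (simp only: mult_ac mult_1_left)
    thus ?thesis using False by simp
  next
    case True
    hence "poly f 0 = 0" using f0 nz by simp
    have "f \<noteq> 0"
      using degree_laguerre_pert[of \<alpha> m c] by (auto simp: f_def n_def)
    hence "a \<noteq> 0" using f by auto
    have "0 \<in> set rs"
    proof -
      have "a * (\<Prod>r\<leftarrow>rs. 0 - r) = 0"
        using \<open>poly f 0 = 0\<close> unfolding f poly_smult poly_root_list .
      thus ?thesis using \<open>a \<noteq> 0\<close> by (auto simp: prod_list_zero_iff)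
    qed
    then obtain xs ys where rs: "rs = xs @ 0 # ys"
      by (meson split_list)
    define qs where "qs = xs @ ys"
    define q where "q = smult a (\<Prod>r\<leftarrow>qs. [:- r, 1:])"
    have rs_prod: "(\<Prod>r\<leftarrow>rs. h r) = h 0 * (\<Prod>r\<leftarrow>qs. h r)" for h :: "complex \<Rightarrow> complex"
      by (simp add: rs qs_def mult_ac)
    have fq: "f = pCons 0 q"
      by (simp add: f rs q_def qs_def mult_ac)
    have len': "length qs = m"
      using len by (simp add: rs qs_def n_def)
    have "pCons 0 (pderiv f) = pCons 0 (smult (of_nat n * (1 + c)) q + smult c (laguerre \<alpha> m))"
      unfolding deriv by (simp add: True fq)
    hence deriv': "pderiv f = smult (of_nat n * (1 + c)) q + smult c (laguerre \<alpha> m)"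
      by simp
    \<comment> \<open>The value \<open>f'(0) = q(0)\<close> enters the divided relation on both sides. The right-hand
    side \<open>n (1 + c) q(0) + c L\<^bsub>n-1\<^esub>(0)\<close> reappears below, multiplied by \<open>c ^ m\<close>, as \<open>n\<close> times the
    value of the core polynomial.\<close>
    have q0: "poly (pderiv f) 0 = poly q 0"
      by (simp add: fq pderiv_pCons)
    hence q0': "poly q 0 = of_nat n * (1 + c) * poly q 0 + c * B"
      by (simp add: deriv' B_def)
    have root: "poly (pderiv f) r = c * poly (laguerre \<alpha> m) r" if "r \<in> set qs" for r
    proof -
      have "poly q r = 0"
        using that by (simp add: q_def poly_root_list prod_list_zero_iff)
      thus ?thesis by (simp add: deriv')
    qed
    define P where "P = (\<Prod>r\<leftarrow>qs. poly (laguerre \<alpha> m) r)"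
    have "(\<Prod>r\<leftarrow>qs. poly (pderiv f) r) = (\<Prod>r\<leftarrow>qs. c * poly (laguerre \<alpha> m) r)"
      using root by (metis (no_types, lifting) map_eq_conv)
    also have "\<dots> = c ^ m * P"
      by (simp only: prod_list_cmult len' P_def)
    finally have 1: "(\<Prod>r\<leftarrow>rs. poly (pderiv f) r) = poly q 0 * (c ^ m * P)"
      by (simp only: rs_prod q0)
    have 2: "S = B * P"
      by (simp only: S_def P_def B_def rs_prod)
    have w': "of_nat n + \<alpha> + c * of_nat n = 0"
      using True by (simp add: w_def algebra_simps)
    \<comment> \<open>With \<open>w = 0\<close> only the term for \<open>k = 0\<close> and the separate monomial survive.\<close>
    have "poly (disc_core \<alpha> m) c =
        (\<Sum>k\<le>m. if k = 0 then (coeff (laguerre \<alpha> n) 1 + c * coeff (laguerre \<alpha> m) 1) * (1 + c) * c ^ m else 0) +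
        B / of_nat n * c ^ n"
      unfolding disc_core_def n_def[symmetric] B_def[symmetric] poly_add poly_sum poly_mult poly_power poly_monom
      by (intro arg_cong2[of _ _ _ _ "(+)"] sum.cong refl) (auto simp: w')
    also have "\<dots> = poly q 0 * (1 + c) * c ^ m + B / of_nat n * c ^ n"
    proof -
      have "coeff (laguerre \<alpha> n) 1 + c * coeff (laguerre \<alpha> m) 1 = coeff f 1"
        by (simp add: f_def n_def coeff_laguerre_pert)
      also have "\<dots> = poly q 0"
        by (simp add: fq poly_0_coeff_0)
      finally show ?thesis by simp
    qed
    finally have 3: "of_nat n * poly (disc_core \<alpha> m) c = c ^ m * (of_nat n * (1 + c) * poly q 0 + c * B)"
      using nz by (simp add: n_def field_simps del: of_nat_Suc)
    show ?thesis
      unfolding 1 2 3 q0'[symmetric] by (simp only: mult_ac)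
  qed
  thus ?thesis unfolding B_def S_def .
qed

section \<open>The degree of the discriminant polynomial\<close>

lemma coeff_quadratic_power:
  fixes u v w :: "'a::comm_ring_1"
  shows coeff_quadratic_power_eq_0: "i > 2 * k \<Longrightarrow> coeff ([:u, v, w:] ^ k) i = 0"
    and coeff_quadratic_power_top: "coeff ([:u, v, w:] ^ k) (2 * k) = w ^ k"
    and coeff_quadratic_power_next: "coeff ([:u, v, w:] ^ Suc k) (Suc (2 * k)) = of_nat (Suc k) * v * w ^ k"
proof -
  have shift: "coeff ([:u, v, w:] * p) (Suc (Suc i)) = u * coeff p (Suc (Suc i)) + v * coeff p (Suc i) + w * coeff p i"
    for p :: "'a poly" and i
    by simp
  show 0: "coeff ([:u, v, w:] ^ k) i = 0" if "i > 2 * k" for i k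
    using that
  proof (induction k arbitrary: i)
    case (Suc k)
    then obtain j where "i = Suc (Suc j)" "j > 2 * k"
      by (metis Suc_lessD Suc_lessE mult_Suc_right add_2_eq_Suc Suc_less_SucD)
    thus ?case
      using Suc.IH by (simp add: shift del: mult_pCons_left)
  qed (simp add: coeff_eq_0)
  show top: "coeff ([:u, v, w:] ^ k) (2 * k) = w ^ k" for k
  proof (induction k)
    case (Suc k)
    thus ?case by (simp add: shift 0 del: mult_pCons_left)
  qed simp
  show "coeff ([:u, v, w:] ^ Suc k) (Suc (2 * k)) = of_nat (Suc k) * v * w ^ k"
  proof (induction k)
    case (Suc k)
    have "coeff ([:u, v, w:] ^ Suc (Suc k)) (Suc (2 * Suc k)) =
        u * coeff ([:u, v, w:] ^ Suc k) (Suc (Suc (Suc (2 * k)))) +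
        v * coeff ([:u, v, w:] ^ Suc k) (2 * Suc k) + w * coeff ([:u, v, w:] ^ Suc k) (Suc (2 * k))"
      unfolding power_Suc[of _ "Suc k"] using shift[of "[:u, v, w:] ^ Suc k" "Suc (2 * k)"] by simp
    also have "\<dots> = v * w ^ Suc k + w * (of_nat (Suc k) * v * w ^ k)"
      unfolding Suc.IH top by (subst 0) auto
    finally show ?case by (simp add: algebra_simps)
  qed simp
qed

text \<open>
  For \<open>n = m + 1 \<ge> 2\<close> the degree is read off from the product with the linear polynomial \<open>W\<close>, which
  has degree \<open>2 n - 1\<close>. This product is a sum of terms \<open>T k\<close> with degree at most \<open>n + k + 1\<close>. The coefficients of \<open>c\<^bsup>2n\<^esup>\<close> in \<open>T n\<close> and \<open>T (n - 1)\<close> cancel, and the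
  coefficient of \<open>c\<^bsup>2n-1\<^esup>\<close>, to which only the last three terms contribute, collapses to
  \<open>(-1)\<^sup>n n\<^bsup>n-2\<^esup> / (n - 1)!\<close>.\<close>

lemma degree_disc_core:
  fixes \<alpha> :: "'a::field_char_0"
  shows "disc_core \<alpha> m \<noteq> 0 \<and> degree (disc_core \<alpha> m) = 2 * m"
proof (cases m)
  case 0
  have "disc_core \<alpha> m = [:- 1:]"
    by (simp add: 0 disc_core_def coeff_laguerre monom_altdef)
  thus ?thesis using 0 by simp
next
  case (Suc j)
  define n where "n = Suc m"
  define N :: 'a where "N = of_nat n"
  have N: "N \<noteq> 0" by (simp add: N_def n_def del: of_nat_Suc)
  define q where "q = [:N + \<alpha>, 2 * N + \<alpha>, N:]"
  define T where "T = (\<lambda>k. [:coeff (laguerre \<alpha> n) k, coeff (laguerre \<alpha> m) k:] * q ^ k * monom 1 (n - k))"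
  have coeff_T: "coeff (T k) (Suc i + (n - k)) =
      coeff (laguerre \<alpha> n) k * coeff (q ^ k) (Suc i) + coeff (laguerre \<alpha> m) k * coeff (q ^ k) i" for k i
    unfolding T_def mult.commute[of _ "monom 1 (n - k)"] coeff_monom_mult by simp
  have T_0: "coeff (T k) i = 0" if "k \<le> n" "i > Suc (n + k)" for k i
  proof -
    from that have "i = Suc (i - Suc (n - k)) + (n - k)" by simp
    moreover have "i - Suc (n - k) > 2 * k" using that by simp
    ultimately show ?thesis
      using coeff_T[of k "i - Suc (n - k)"] by (simp add: q_def coeff_quadratic_power_eq_0)
  qed
  have lm: "coeff (laguerre \<alpha> n) n = (-1) ^ n / fact n" "coeff (laguerre \<alpha> m) n = 0"
    "coeff (laguerre \<alpha> n) m = (N + \<alpha>) * (-1) ^ m / fact m" "coeff (laguerre \<alpha> m) m = (-1) ^ m / fact m"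
    "coeff (laguerre \<alpha> m) j = (of_nat m + \<alpha>) * (-1) ^ j / fact j"
    by (simp_all add: coeff_laguerre n_def N_def Suc Suc_diff_le del: of_nat_Suc fact_Suc power_Suc)
  have prod: "[:of_nat n + \<alpha>, of_nat n:] * disc_core \<alpha> m = (\<Sum>k\<le>n. T k)"
    using linear_times_disc_core[of m \<alpha>] unfolding n_def[symmetric] T_def q_def N_def by simp
  have "(\<Sum>k\<le>n. T k) = (\<Sum>k<j. T k) + T j + T m + T n"
    by (simp add: n_def Suc flip: lessThan_Suc_atMost)
  \<comment> \<open>The terms with \<open>k < j = n - 2\<close> have degree at most \<open>2 n - 2\<close>.\<close>
  hence coeff_G: "coeff (\<Sum>k\<le>n. T k) i = coeff (T j) i + coeff (T m) i + coeff (T n) i" if "i \<ge> Suc (2 * m)" for i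
    using that T_0 by (simp add: coeff_sum n_def Suc)
  have "coeff (\<Sum>k\<le>n. T k) i = 0" if i: "i > Suc (2 * m)" for i
  proof -
    have Tj: "coeff (T j) i = 0"
      using i by (intro T_0) (auto simp: n_def Suc)
    show ?thesis
    proof (cases "i = 2 * n")
      case True
      have "coeff (T m) i = (-1) ^ m / fact m * N ^ m"
        using coeff_T[of m "2 * m"] by (simp add: True n_def q_def coeff_quadratic_power lm)
      moreover have "coeff (T n) i = (-1) ^ n / fact n * N ^ n"
        using coeff_T[of n "Suc (2 * m)"] by (simp add: True lm) (simp add: n_def q_def coeff_quadratic_power_top[of _ _ _ "Suc m", simplified])
      ultimately show ?thesis
        using i N by (simp add: coeff_G Tj) (simp add: n_def N_def divide_simps del: of_nat_Suc)
    next
      case False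
      hence "i > 2 * n" using i by (simp add: n_def)
      then obtain i' where i': "i = Suc i'" "i' \<ge> 2 * n" by (cases i) auto
      have "coeff (T m) i = 0"
        using \<open>i > 2 * n\<close> by (intro T_0) (auto simp: n_def)
      moreover have "coeff (T n) i = 0"
        using coeff_T[of n i'] i' by (simp add: lm q_def coeff_quadratic_power_eq_0)
      ultimately show ?thesis using i by (simp add: coeff_G Tj)
    qed
  qed
  hence deg_le: "degree (\<Sum>k\<le>n. T k) \<le> Suc (2 * m)"
    by (intro degree_le) auto
  have "coeff (\<Sum>k\<le>n. T k) (Suc (2 * m)) = (-1) ^ n * N ^ j / fact m"
  proof -
    have 1: "coeff (T n) (Suc (2 * m)) = (-1) ^ n / fact n * (N * (2 * N + \<alpha>) * N ^ m)"
      using coeff_T[of n "2 * m"] by (simp add: lm) (simp only: n_def q_def N_def coeff_quadratic_power_next)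
    have 2: "coeff (T m) (Suc (2 * m)) = (N + \<alpha>) * (-1) ^ m / fact m * N ^ m +
        (-1) ^ m / fact m * (of_nat m * (2 * N + \<alpha>) * N ^ j)"
    proof -
      have "coeff (q ^ m) (Suc (2 * j)) = of_nat m * (2 * N + \<alpha>) * N ^ j"
        unfolding q_def Suc by (rule coeff_quadratic_power_next)
      moreover have "coeff (q ^ m) (2 * m) = N ^ m"
        unfolding q_def by (rule coeff_quadratic_power_top)
      moreover have "Suc (2 * m) = Suc (Suc (2 * j)) + (n - m)" "Suc (Suc (2 * j)) = 2 * m"
        by (simp_all add: n_def Suc)
      ultimately show ?thesis
        using coeff_T[of m "Suc (2 * j)"] by (simp only: lm)
    qed
    have 3: "coeff (T j) (Suc (2 * m)) = (of_nat m + \<alpha>) * (-1) ^ j / fact j * N ^ j"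
    proof -
      have "Suc (2 * m) = Suc (2 * j) + (n - j)"
        by (simp add: n_def Suc)
      thus ?thesis
        using coeff_T[of j "2 * j"] by (simp add: lm q_def coeff_quadratic_power)
    qed
    have fj: "1 / fact j = of_nat m * (1 / fact m :: 'a)"
      by (simp add: Suc del: of_nat_Suc)
    have fn: "N * (1 / fact n) = (1 / fact m :: 'a)"
      using N by (simp add: n_def N_def del: of_nat_Suc)
    have m: "of_nat m = N - 1" by (simp add: N_def n_def)
    define r :: 'a where "r = 1 / fact m"
    have sgn: "(-1) ^ j = ((-1) ^ n :: 'a)" "(-1) ^ m = - ((-1) ^ n :: 'a)" "N ^ m = N * N ^ j"
      by (simp_all add: n_def Suc)
    have "coeff (\<Sum>k\<le>n. T k) (Suc (2 * m)) =
        coeff (T j) (Suc (2 * m)) + coeff (T m) (Suc (2 * m)) + coeff (T n) (Suc (2 * m))"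
      by (rule coeff_G) simp
    also have "\<dots> =
        (-1) ^ n * N ^ j * ((of_nat m + \<alpha>) * (1 / fact j) - N * (N + \<alpha>) * (1 / fact m)
          - of_nat m * (2 * N + \<alpha>) * (1 / fact m) + N * (2 * N + \<alpha>) * (N * (1 / fact n)))"
      unfolding 1 2 3 sgn divide_inverse by (simp add: algebra_simps del: fact_Suc)
    also have "\<dots> = (-1) ^ n * N ^ j * (1 / fact m)"
      unfolding fj fn m r_def[symmetric] by (simp add: algebra_simps)
    finally show ?thesis by simp
  qed
  hence nz: "coeff (\<Sum>k\<le>n. T k) (Suc (2 * m)) \<noteq> 0"
    using N by simp
  hence "degree (\<Sum>k\<le>n. T k) = Suc (2 * m)"
    using deg_le le_degree by (metis antisym)
  moreover have "disc_core \<alpha> m \<noteq> 0"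
    using nz unfolding prod[symmetric] by auto
  moreover from this have "degree ([:of_nat n + \<alpha>, of_nat n:] * disc_core \<alpha> m) = Suc (degree (disc_core \<alpha> m))"
    using N by (subst degree_mult_eq) (auto simp: N_def)
  ultimately show ?thesis
    unfolding prod by simp
qed

section \<open>Collecting the constants\<close>

text \<open>
  This turns the factorials that Schur's recursion produces into the powers \<open>k ^ k\<close> that the
  discriminant formula displays.\<close>

lemma superfactorial_times_hyperfactorial:
  "(\<Prod>k=1..m. fact k) * (\<Prod>k=1..Suc m. of_nat k ^ k) = (fact (Suc m) ^ Suc m :: 'a::{semiring_char_0,comm_semiring_1})"
proof (induction m)
  case (Suc m)
  have "(\<Prod>k=1..Suc m. fact k) * (\<Prod>k=1..Suc (Suc m). of_nat k ^ k) =
      ((\<Prod>k=1..m. fact k) * (\<Prod>k=1..Suc m. of_nat k ^ k)) * (fact (Suc m) * of_nat (Suc (Suc m)) ^ Suc (Suc m) :: 'a)"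
    by (simp add: prod.nat_ivl_Suc' mult_ac del: of_nat_Suc fact_Suc power_Suc)
  also have "\<dots> = (of_nat (Suc (Suc m)) * fact (Suc m)) ^ Suc (Suc m)"
    unfolding Suc.IH power_mult_distrib by (simp only: power_Suc mult_ac)
  also have "of_nat (Suc (Suc m)) * fact (Suc m) = (fact (Suc (Suc m)) :: 'a)"
    by (simp only: fact_Suc of_nat_mult)
  finally show ?case .
qed simp

lemma prod_powi_eq:
  fixes m :: nat
  defines "n \<equiv> Suc m"
  shows "(\<Prod>k=1..n. of_nat k powi (int k - 2 * int n + 3)) * fact n ^ (2 * m) * (\<Prod>k=1..m. fact k) =
           (fact n ^ Suc n :: 'a::field_char_0)"
proof -
  have "(\<Prod>k=1..n. of_nat k powi (int k - 2 * int n + 3)) * fact n ^ (2 * m) =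
      (\<Prod>k=1..n. of_nat k powi (int k - 2 * int n + 3) * of_nat k ^ (2 * m) :: 'a)"
    by (simp add: prod.distrib fact_prod prod_power_distrib)
  also have "\<dots> = (\<Prod>k=1..n. of_nat k * of_nat k ^ k)"
  proof (rule prod.cong[OF refl])
    fix k assume "k \<in> {1..n}"
    hence "(of_nat k :: 'a) \<noteq> 0" by simp
    hence "(of_nat k :: 'a) powi (int k - 2 * int n + 3) * of_nat k powi int (2 * m) = of_nat k powi int (Suc k)"
      by (subst power_int_add[symmetric]) (auto simp: n_def)
    thus "(of_nat k :: 'a) powi (int k - 2 * int n + 3) * of_nat k ^ (2 * m) = of_nat k * of_nat k ^ k"
      by (simp only: power_int_of_nat power_Suc)
  qed
  also have "\<dots> = fact n * (\<Prod>k=1..n. of_nat k ^ k)"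
    by (simp add: prod.distrib fact_prod)
  finally show ?thesis
    using superfactorial_times_hyperfactorial[of m, where 'a = 'a]
    by (simp add: n_def mult_ac del: fact_Suc)
qed

text \<open>
  The sign of the discriminant cancels the sign of the resultant, and dividing by \<open>L\<^bsub>n-1\<^esub>(0)\<close>
  lowers the exponents of \<open>k + \<alpha>\<close> by one.\<close>

lemma sign_times_prod_laguerre:
  fixes \<alpha> :: "'a::field_char_0"
  shows "(\<Prod>j<Suc m. (-1) ^ j) * (\<Prod>k=1..m. (-1) ^ k * (of_nat k + \<alpha>) ^ k / fact k) * (\<Prod>k=1..m. fact k) =
           fact m * poly (laguerre \<alpha> m) 0 * (\<Prod>k=1..m. (of_nat k + \<alpha>) ^ (k - 1))"
proof -
  have "(\<Prod>j<Suc m. (-1) ^ j) = (\<Prod>k=1..m. (-1) ^ k :: 'a)"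
    by (induction m) (simp_all add: prod.nat_ivl_Suc' mult_ac)
  hence "(\<Prod>j<Suc m. (-1) ^ j) * (\<Prod>k=1..m. (-1) ^ k * (of_nat k + \<alpha>) ^ k / fact k) * (\<Prod>k=1..m. fact k) =
      (\<Prod>k=1..m. (-1) ^ k * ((-1) ^ k * (of_nat k + \<alpha>) ^ k / fact k) * fact k)"
    by (simp only: prod.distrib)
  also have "\<dots> = (\<Prod>k=1..m. (of_nat k + \<alpha>) * (of_nat k + \<alpha>) ^ (k - 1))"
  proof (rule prod.cong[OF refl])
    fix k assume "k \<in> {1..m}"
    have "(-1) ^ k * ((-1) ^ k * (of_nat k + \<alpha>) ^ k / fact k) * fact k =
        ((-1) ^ k * (-1) ^ k) * (of_nat k + \<alpha>) ^ k"
      by simp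
    also have "(-1) ^ k * (-1) ^ k = (1 :: 'a)"
      by (simp flip: power_mult_distrib)
    also have "1 * (of_nat k + \<alpha>) ^ k = (of_nat k + \<alpha>) * (of_nat k + \<alpha>) ^ (k - 1)"
      using \<open>k \<in> {1..m}\<close> by (cases k) simp_all
    finally show "(-1) ^ k * ((-1) ^ k * (of_nat k + \<alpha>) ^ k / fact k) * fact k =
        (of_nat k + \<alpha>) * (of_nat k + \<alpha>) ^ (k - 1)" .
  qed
  finally show ?thesis
    by (simp add: prod.distrib poly_laguerre_0)
qed

text \<open>
  The assumption says \<open>L\<^bsub>n-1\<^esub>(0) \<noteq> 0\<close>, which allows cancelling this factor from
  \<open>prod_pderiv_over_roots\<close>. What remains is bookkeeping of constants.\<close>

lemma discriminant_laguerre_pert: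
  fixes \<alpha> c :: complex and m :: nat
  defines "n \<equiv> Suc m"
  assumes \<alpha>: "\<And>k. k \<in> {1..m} \<Longrightarrow> of_nat k + \<alpha> \<noteq> 0"
  shows "discriminant (laguerre_pert \<alpha> n c) =
           (-1) ^ n * (\<Prod>k=1..n. of_nat k powi (int k - 2 * int n + 3)) *
           (\<Prod>k=1..m. (of_nat k + \<alpha>) ^ (k - 1)) * poly (disc_core \<alpha> m) c"
proof -
  define a :: complex where "a = (-1) ^ n / fact n"
  define f where "f = laguerre_pert \<alpha> n c"
  define H where "H = poly (disc_core \<alpha> m) c"
  define B where "B = poly (laguerre \<alpha> m) 0"
  define S where "S = (\<Prod>k=1..m. (-1) ^ k * (of_nat k + \<alpha>) ^ k / fact k)"
  define sgn :: complex where "sgn = (\<Prod>j<n. (-1) ^ j)"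
  define P1 :: complex where "P1 = (\<Prod>k=1..n. of_nat k powi (int k - 2 * int n + 3))"
  define P2 where "P2 = (\<Prod>k=1..m. (of_nat k + \<alpha>) ^ (k - 1))"
  define F :: complex where "F = (\<Prod>k=1..m. fact k)"
  define D where "D = fact n ^ (2 * m) * F"
  have F: "F \<noteq> 0" by (simp add: F_def)
  obtain rs where rs: "f = smult a (\<Prod>r\<leftarrow>rs. [:- r, 1:])" "length rs = n"
    unfolding f_def n_def a_def by (rule laguerre_pert_root_list_ex)
  have S: "(\<Prod>r\<leftarrow>rs. poly (laguerre \<alpha> m) r) = S"
    unfolding S_def using rs unfolding f_def n_def a_def by (rule prod_laguerre_over_roots)
  have a: "a \<noteq> 0" by (simp add: a_def)
  have B: "B \<noteq> 0"
    using \<alpha> by (simp add: B_def poly_laguerre_0)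
  have a1: "a ^ n = (-1) ^ n / fact n ^ n"
    by (cases "even n") (simp_all add: a_def power_divide flip: power_mult)
  have a2: "a ^ (2 * n - 2) = 1 / fact n ^ (2 * m)"
    by (simp add: a_def n_def power_divide power_mult[symmetric] mult.commute[of "Suc m"] del: fact_Suc power_Suc)
  have "a ^ n * discriminant f = a ^ (2 * n - 2) * sgn * (\<Prod>r\<leftarrow>rs. poly (pderiv f) r)"
    unfolding sgn_def by (rule discriminant_pderiv[OF rs(1) a rs(2)])
  moreover have "B * (\<Prod>r\<leftarrow>rs. poly (pderiv f) r) = of_nat n * H * S"
    using prod_pderiv_over_roots[where m = m and \<alpha> = \<alpha> and c = c and a = a and rs = rs] rs
    unfolding S n_def f_def B_def H_def by simp
  ultimately have 1: "B * a ^ n * discriminant f = a ^ (2 * n - 2) * sgn * (of_nat n * H * S)"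
    by (metis mult.assoc mult.left_commute)
  have 2: "sgn * S * F = fact m * B * P2"
    unfolding sgn_def S_def F_def B_def P2_def n_def by (rule sign_times_prod_laguerre)
  have 3: "P1 * D = fact n ^ Suc n"
    unfolding P1_def D_def F_def n_def mult.assoc[symmetric] by (rule prod_powi_eq)
  have "B * (-1) ^ n * D * discriminant f = fact n ^ n * fact n ^ (2 * m) * F * (B * a ^ n * discriminant f)"
    by (simp add: a1 D_def)
  also have "\<dots> = fact n ^ n * of_nat n * H * (sgn * S * F)"
    unfolding 1 a2 by simp
  also have "\<dots> = B * (fact n ^ n * (of_nat n * fact m)) * H * P2"
    unfolding 2 by (simp only: mult_ac)
  also have "of_nat n * fact m = (fact n :: complex)"
    by (simp only: n_def fact_Suc)
  also have "fact n ^ n * fact n = P1 * D"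
    unfolding 3 by simp
  finally have "B * D * ((-1) ^ n * discriminant f) = B * D * (P1 * P2 * H)"
    by (simp only: mult_ac)
  moreover have "D \<noteq> 0" using F by (simp add: D_def)
  ultimately have "(-1) ^ n * discriminant f = P1 * P2 * H"
    using B by simp
  hence "(-1) ^ n * (-1) ^ n * discriminant f = (-1) ^ n * (P1 * P2 * H)"
    by (simp only: mult.assoc)
  moreover have "(-1) ^ n * (-1) ^ n = (1 :: complex)"
    by (simp flip: power_mult_distrib)
  ultimately show ?thesis
    by (simp add: f_def H_def P1_def P2_def mult.assoc)
qed

text \<open>
  The factor \<open>c ^ n\<close> clears the denominators, and what is left is the homogenised sum that
  \<open>poly_disc_core\<close> factors.\<close>

lemma poly_laguerre_pert_at_cofactor_root:
  fixes \<alpha> c :: "'a::field_char_0" and m :: nat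
  defines "n \<equiv> Suc m"
  assumes "c \<noteq> 0"
  shows "c ^ n * poly (laguerre_pert \<alpha> n c) ((of_nat n * c\<^sup>2 + (2 * of_nat n + \<alpha>) * c + of_nat n + \<alpha>) / c) =
           (of_nat n * c + of_nat n + \<alpha>) * poly (disc_core \<alpha> m) c"
proof -
  define N where "N = (1 + c) * (of_nat n * c + of_nat n + \<alpha>)"
  have "of_nat n * c\<^sup>2 + (2 * of_nat n + \<alpha>) * c + of_nat n + \<alpha> = N"
    by (simp add: N_def algebra_simps power2_eq_square)
  moreover have "c ^ n * poly (laguerre_pert \<alpha> n c) (N / c) =
      (\<Sum>k\<le>n. c ^ n * (coeff (laguerre_pert \<alpha> n c) k * (N / c) ^ k))"
    unfolding poly_altdef sum_distrib_left using degree_laguerre_pert[of \<alpha> m c] by (simp add: n_def)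
  moreover have "\<dots> = (\<Sum>k\<le>n. coeff (laguerre_pert \<alpha> n c) k * N ^ k * c ^ (n - k))"
    using \<open>c \<noteq> 0\<close> by (intro sum.cong) (auto simp: power_diff power_divide)
  ultimately show ?thesis
    using poly_disc_core[of m c \<alpha>] by (simp only: n_def N_def)
qed

theorem theorem4p8:
  fixes \<alpha> :: real and n :: nat
  assumes "\<alpha> > -1" and "n \<ge> 1"
  shows "let a = complex_of_real \<alpha>;
             L = laguerre_pert a n;
             rhs = (\<lambda>c::complex.
               1 / (of_nat n + a + c * of_nat n) *
               (\<Prod>k=1..n. of_nat k powi (int k - 2 * int n + 3)) *
               (\<Prod>k=1..n-1. (of_nat k + a) ^ (k - 1)) *
               ((- c) ^ n *
                poly (L c) ((of_nat n * c\<^sup>2 + (2 * of_nat n + a) * c + of_nat n + a) / c)))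
         in (\<forall>c. c \<noteq> 0 \<and> of_nat n + a + c * of_nat n \<noteq> 0 \<longrightarrow> discriminant (L c) = rhs c) \<and>
            (\<forall>c. c = 0 \<or> of_nat n + a + c * of_nat n = 0 \<longrightarrow> (rhs \<longlongrightarrow> discriminant (L c)) (at c)) \<and>
            (\<exists>p :: complex poly. p \<noteq> 0 \<and> degree p = 2 * (n - 1) \<and>
               (\<forall>c. discriminant (L c) = poly p c))"
proof -
  define a where "a = complex_of_real \<alpha>"
  define L where "L = laguerre_pert a n"
  define P1 :: complex where "P1 = (\<Prod>k=1..n. of_nat k powi (int k - 2 * int n + 3))"
  define P2 where "P2 = (\<Prod>k=1..n-1. (of_nat k + a) ^ (k - 1))"
  define rhs where "rhs = (\<lambda>c::complex. 1 / (of_nat n + a + c * of_nat n) * P1 * P2 *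
    ((- c) ^ n * poly (L c) ((of_nat n * c\<^sup>2 + (2 * of_nat n + a) * c + of_nat n + a) / c)))"
  define p where "p = smult ((-1) ^ n * P1 * P2) (disc_core a (n - 1))"
  have n: "Suc (n - 1) = n" using assms by simp
  have a: "of_nat k + a \<noteq> 0" if "k \<in> {1..n - 1}" for k
  proof -
    have "real k + \<alpha> \<noteq> 0" using that assms by auto
    hence "complex_of_real (real k + \<alpha>) \<noteq> 0" unfolding of_real_eq_0_iff .
    thus ?thesis by (simp add: a_def)
  qed
  have disc: "discriminant (L c) = poly p c" for c
    using discriminant_laguerre_pert[of "n - 1" a c] a unfolding n by (simp add: L_def P1_def P2_def p_def)
  have rhs: "rhs c = poly p c" if c: "c \<noteq> 0" "of_nat n + a + c * of_nat n \<noteq> 0" for c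
  proof -
    define w where "w = of_nat n + a + c * of_nat n"
    have w: "w \<noteq> 0" using c by (simp add: w_def)
    have "c ^ n * poly (L c) ((of_nat n * c\<^sup>2 + (2 * of_nat n + a) * c + of_nat n + a) / c) =
        w * poly (disc_core a (n - 1)) c"
      using poly_laguerre_pert_at_cofactor_root[OF c(1), of "n - 1" a] unfolding n by (simp add: L_def w_def algebra_simps)
    thus ?thesis
      using w unfolding rhs_def w_def[symmetric] power_minus[of c] mult.assoc by (simp add: p_def mult_ac)
  qed
  have lim: "(rhs \<longlongrightarrow> discriminant (L c)) (at c)" for c
  proof -
    \<comment> \<open>Only two points are exceptional, so the right-hand side agrees with \<open>p\<close> in a punctured neighbourhood.\<close>
    have "\<forall>\<^sub>F z in at c. z \<noteq> 0 \<and> z \<noteq> - (of_nat n + a) / of_nat n"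
      by (intro eventually_conj eventually_neq_at_within)
    hence "\<forall>\<^sub>F z in at c. poly p z = rhs z"
    proof eventually_elim
      case (elim z)
      have "of_nat n + a + z * of_nat n \<noteq> 0"
      proof
        assume "of_nat n + a + z * of_nat n = 0"
        hence "z * of_nat n = - (of_nat n + a)"
          by (simp only: add_eq_0_iff)
        hence "z = - (of_nat n + a) / of_nat n"
          using assms(2) by (simp add: eq_divide_eq)
        thus False using elim by simp
      qed
      thus ?case using rhs elim by simp
    qed
    moreover have "(poly p \<longlongrightarrow> poly p c) (at c)"
      by (intro tendsto_poly tendsto_ident_at)
    ultimately show ?thesis
      unfolding disc by (rule Lim_transform_eventually[rotated])
  qed
  have "P1 \<noteq> 0" by (auto simp: P1_def)
  moreover have "P2 \<noteq> 0" using a by (auto simp: P2_def)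
  ultimately have p: "p \<noteq> 0 \<and> degree p = 2 * (n - 1)"
    using degree_disc_core[of a "n - 1"] by (simp add: p_def)
  have "(\<forall>c. c \<noteq> 0 \<and> of_nat n + a + c * of_nat n \<noteq> 0 \<longrightarrow> discriminant (L c) = rhs c) \<and>
      (\<forall>c. c = 0 \<or> of_nat n + a + c * of_nat n = 0 \<longrightarrow> (rhs \<longlongrightarrow> discriminant (L c)) (at c)) \<and>
      (\<exists>p :: complex poly. p \<noteq> 0 \<and> degree p = 2 * (n - 1) \<and> (\<forall>c. discriminant (L c) = poly p c))"
    using rhs lim p disc by (intro conjI allI impI exI[of _ p]) simp_all
  thus ?thesis
    unfolding rhs_def P1_def P2_def L_def a_def Let_def .
qed

end
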